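(* Let $TW$ denote the terminal Wiener index, $EPL$ the external path length and $LV$ the number of leaves of a rooted tree, and write $S(n)=S(\tau(n))$ for each of these statistics $S$, where $\tau(n)$ is the rooted tree with Matula number $n$. Then for every positive integer $n$, where in the composite case the factorization $n=rs$ is chosen with $r$ prime, $$TW(n)=\begin{cases}0, & \text{if } n=1;\\ 1, & \text{if } n=2;\\ TW(t)+LV(t), & \text{if } n=p_t \text{ and } \Omega(t)=1 \text{ (i.e. } t \text{ is prime)};\\ TW(t)+EPL(t)+LV(t), & \text{if } n=p_t \text{ and } \Omega(t)>1;\\ TW(r)-EPL(r)+TW(s)-EPL(s)+EPL(r)LV(s)+EPL(s)LV(r), & \text{if } n=rs,\ r,s\ge 2,\ r \text{ prime},\ s \text{ prime};\\ TW(r)-EPL(r)+TW(s)+EPL(r)LV(s)+EPL(s)LV(r), & \text{if } n=rs,\ r,s\ge 2,\ r \text{ prime},\ s \text{ not prime}.\end{cases}$$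
   Context: For $m\ge 1$ let $p_m$ denote the $m$-th prime ($p_1=2,p_2=3,p_3=5,\dots$). For a positive integer $n$, $\Omega(n)$ is the number of prime divisors of $n$ counted with multiplicity. Rooted trees are finite and considered up to isomorphism of rooted trees. The Matula number $\mu(T)$ of a rooted tree $T$ is defined recursively: $\mu(T)=1$ for the one-vertex tree; otherwise, if $T_1,\dots,T_d$ are the subtrees rooted at the vertices adjacent to the root of $T$, then $\mu(T)=p_{\mu(T_1)}p_{\mu(T_2)}\cdots p_{\mu(T_d)}$. The map $\mu$ is a bijection from rooted trees to positive integers, and $\tau(n)$ denotes the rooted tree with Matula number $n$. Equivalently: $\tau(1)$ is the one-vertex tree; $\tau(p_t)$ is obtained from $\tau(t)$ by adding a new vertex, which becomes the root, joined by an edge to the root of $\tau(t)$; and, for $r,s\ge 2$, $\tau(rs)$ is obtained from $\tau(r)$ and $\tau(s)$ by identifying their roots. For a statistic $S$ on rooted trees, $S(n)$ means $S(\tau(n))$. A pendant vertex is a vertex of degree 1 (the root may be pendant). The terminal Wiener index of a tree is the sum of the distances between all unordered pairs of pendant vertices. A leaf of a rooted tree is a vertex having no children, except that in the one-vertex tree the root is not considered a leaf. The level of a vertex is its distance from the root. The external path length is the sum of the levels of all leaves. *)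

theory Defs
  imports "HOL-Library.Multiset" "HOL-Library.Infinite_Set" "HOL-Computational_Algebra.Primes"
begin

section \<open>Rooted trees and Matula numbers\<close>

text \<open>
  A finite rooted tree up to isomorphism is the multiset of its branches, i.e. of the subtrees
  rooted at the vertices adjacent to the root, again taken up to isomorphism.
\<close>

datatype rtree = Node "rtree multiset"

text \<open>The primes are indexed from 1; the argument 0 is irrelevant.\<close>

definition nth_prime :: "nat \<Rightarrow> nat" where
  "nth_prime m = enumerate {p. prime p} (m - 1)"

text \<open>The empty product covers the one-vertex tree.\<close>

primrec matula :: "rtree \<Rightarrow> nat" where
  "matula (Node M) = prod_mset (image_mset (\<lambda>T. nth_prime (matula T)) M)"

text \<open>Since \<open>matula\<close> is a bijection onto the positive integers, this is meaningful for \<open>n > 0\<close>.\<close>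

definition tau :: "nat \<Rightarrow> rtree" where
  "tau n = (THE T. matula T = n)"

definition Omega :: "nat \<Rightarrow> nat" where
  "Omega n = size (prime_factorization n)"

section \<open>The underlying graph\<close>

text \<open>
  A vertex is addressed by the descent from the root \<open>[]\<close> leading to it. A step \<open>(T, i)\<close> enters
  the \<open>i\<close>-th copy of the branch \<open>T\<close>; the index keeps isomorphic branches at a vertex apart.
\<close>

type_synonym vertex = "(rtree \<times> nat) list"

fun is_vertex :: "rtree \<Rightarrow> vertex \<Rightarrow> bool" where
  "is_vertex T [] \<longleftrightarrow> True"
| "is_vertex (Node M) ((T, i) # v) \<longleftrightarrow> i < count M T \<and> is_vertex T v"

definition verts :: "rtree \<Rightarrow> vertex set" where
  "verts T = {v. is_vertex T v}"

definition children :: "rtree \<Rightarrow> vertex \<Rightarrow> vertex set" where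
  "children T v = {w \<in> verts T. \<exists>x. w = v @ [x]}"

definition adj :: "rtree \<Rightarrow> vertex \<Rightarrow> vertex \<Rightarrow> bool" where
  "adj T v w \<longleftrightarrow> v \<in> verts T \<and> w \<in> verts T \<and> (w \<in> children T v \<or> v \<in> children T w)"

definition degree :: "rtree \<Rightarrow> vertex \<Rightarrow> nat" where
  "degree T v = card {w. adj T v w}"

text \<open>The relational power \<open>(adj T ^^ k) v w\<close> says that there is a walk of length \<open>k\<close>.\<close>

definition distance :: "rtree \<Rightarrow> vertex \<Rightarrow> vertex \<Rightarrow> nat" where
  "distance T v w = (LEAST k. (adj T ^^ k) v w)"

definition level :: "rtree \<Rightarrow> vertex \<Rightarrow> nat" where
  "level T v = distance T [] v"

section \<open>Statistics\<close>

definition pendant :: "rtree \<Rightarrow> vertex set" where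
  "pendant T = {v \<in> verts T. degree T v = 1}"

text \<open>The root of the one-vertex tree \<open>Node {#}\<close> is by convention not a leaf.\<close>

definition leaves :: "rtree \<Rightarrow> vertex set" where
  "leaves T = {v \<in> verts T. children T v = {} \<and> T \<noteq> Node {#}}"

text \<open>Well-defined on unordered pairs because \<open>distance\<close> is symmetric.\<close>

definition pair_distance :: "rtree \<Rightarrow> vertex set \<Rightarrow> nat" where
  "pair_distance T e = (THE d. \<exists>v w. e = {v, w} \<and> d = distance T v w)"

definition terminal_wiener :: "rtree \<Rightarrow> nat" where
  "terminal_wiener T = (\<Sum>e \<in> {e. e \<subseteq> pendant T \<and> card e = 2}. pair_distance T e)"

definition num_leaves :: "rtree \<Rightarrow> nat" where
  "num_leaves T = card (leaves T)"

definition external_path_length :: "rtree \<Rightarrow> nat" where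
  "external_path_length T = (\<Sum>v \<in> leaves T. level T v)"

text \<open>Statistics as functions of the Matula number, integer-valued since differences occur.\<close>

definition TW :: "nat \<Rightarrow> int" where
  "TW n = int (terminal_wiener (tau n))"

definition LV :: "nat \<Rightarrow> int" where
  "LV n = int (num_leaves (tau n))"

definition EPL :: "nat \<Rightarrow> int" where
  "EPL n = int (external_path_length (tau n))"

end

theory Submission
  imports Defs
begin

text \<open>
  The root is pendant exactly when it has one child, and every other pendant vertex is a leaf.
  Hence the terminal Wiener index is the Wiener sum over pairs of leaves, to which the external
  path length is added when the root has one child, that is, when the Matula number is prime. All
  case distinctions and all subtracted external path lengths in the recurrence come from this
  correction (\<open>terminal_wiener_eq\<close>, \<open>TW_eq\<close>); the leaf part behaves uniformly.

  Planting a nontrivial tree below a new root keeps the leaves and their mutual distances and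
  moves each leaf one level down (\<open>statistics_plant\<close>). Joining two trees at the root keeps the
  distances inside each part, while a path between leaves of different parts passes through the
  root, so its length is the sum of the two levels; summing over all such pairs gives the two mixed
  products (\<open>wiener_sum_join\<close>).

  These arguments need a usable form of the graph distance. In terms of addresses, the shortest
  path climbs to the longest common prefix and descends again (\<open>distance_eq_addr_dist\<close>).
  Finally, unique factorization makes \<open>matula\<close> a bijection onto the positive integers, so
  \<open>tau\<close> turns multiplication into joining and \<open>nth_prime\<close> into planting
  (\<open>tau_mult\<close>, \<open>tau_nth_prime\<close>).
\<close>

section \<open>Matula numbers\<close>

lemma infinite_primes: "infinite {p::nat. prime p}"
  using primes_infinite by simp

lemma prime_nth_prime: "prime (nth_prime m)"
  using enumerate_in_set[OF infinite_primes] by (simp add: nth_prime_def)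

lemma nth_prime_inj: "m \<ge> 1 \<Longrightarrow> k \<ge> 1 \<Longrightarrow> nth_prime m = nth_prime k \<Longrightarrow> m = k"
  using strict_mono_eq[OF strict_mono_enumerate[OF infinite_primes]]
  unfolding nth_prime_def by fastforce

text \<open>
  This makes the recursion from \<open>n\<close> to the indices of its prime factors well-founded, which is
  what surjectivity of \<open>matula\<close> rests on.
\<close>

lemma less_nth_prime: "m < nth_prime m"
proof -
  let ?e = "enumerate {p::nat. prime p}"
  have "k + 2 \<le> ?e k" for k
  proof (induction k)
    case 0
    have "prime (?e 0)"
      using enumerate_in_set[OF infinite_primes, of 0] by (simp only: mem_Collect_eq)
    from prime_ge_2_nat[OF this] show ?case
      by (simp only: add_0)
  next
    case (Suc k)
    have "?e k < ?e (Suc k)"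
      by (rule enumerate_step[OF infinite_primes])
    then show ?case
      using Suc.IH by linarith
  qed
  from this[of "m - 1"] have "m - 1 + 2 \<le> nth_prime m"
    by (simp only: nth_prime_def)
  then show ?thesis
    by linarith
qed

lemma prime_eq_nth_prime:
  assumes "prime p"
  obtains m where "m \<ge> 1" "p = nth_prime m"
proof -
  obtain k where "enumerate {p. prime p} k = p"
    using enumerate_Ex[of "{p. prime p}" p] assms infinite_primes by auto
  then show ?thesis
    using that[of "Suc k"] by (simp add: nth_prime_def)
qed

text \<open>
  The prime factorization reads off the branches at the root together with their multiplicities.
\<close>

lemma prime_factorization_matula:
  "prime_factorization (matula (Node M)) = image_mset (\<lambda>T. nth_prime (matula T)) M"
  by (auto intro!: prime_factorization_prod_mset_primes simp: prime_nth_prime)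

lemma matula_pos: "matula T \<ge> 1"
proof (cases T)
  case (Node M)
  have "prod_mset (image_mset (\<lambda>T. nth_prime (matula T)) M) > 0"
    by (induction M) (auto simp: prime_gt_0_nat prime_nth_prime)
  then show ?thesis
    by (simp add: Node)
qed

text \<open>
  Equal Matula numbers have equal multisets of prime factors; by induction each prime factor
  determines its branch, so the multisets of branches agree as well.
\<close>

lemma matula_inj: "matula S = matula T \<Longrightarrow> S = T"
proof (induction S arbitrary: T)
  case (Node M)
  obtain N where N: "T = Node N"
    by (cases T)
  let ?f = "\<lambda>T. nth_prime (matula T)"
  have img: "image_mset ?f M = image_mset ?f N"
    using Node.prems by (metis N prime_factorization_matula)
  then have sub: "?f ` set_mset M = ?f ` set_mset N"
    by (metis set_image_mset)
  have eq: "x = y" if "x \<in># M" "?f x = ?f y" for x y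
    using that Node.IH nth_prime_inj matula_pos by blast
  have "inj_on ?f (set_mset M)"
    using eq by (auto simp: inj_on_def)
  moreover have "set_mset N \<subseteq> set_mset M"
  proof
    fix y assume "y \<in># N"
    then obtain x where "x \<in># M" "?f x = ?f y"
      using sub by (metis (no_types, lifting) image_iff)
    then show "y \<in># M"
      using eq by auto
  qed
  \<comment> \<open>One left inverse of \<open>?f\<close> serves both \<open>M\<close> and \<open>N\<close>, so it recovers both from the common image.\<close>
  ultimately have inv: "inv_into (set_mset M) ?f (?f x) = x" if "x \<in># M \<or> x \<in># N" for x
    using that inv_into_f_f subsetD by metis
  have "image_mset (inv_into (set_mset M) ?f) (image_mset ?f L) = L" if "L = M \<or> L = N" for L
    unfolding multiset.map_comp
    by (rule multiset.map_ident_strong) (use that inv in force)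
  then show ?case
    using img N by metis
qed

lemma matula_surj: "n \<ge> 1 \<Longrightarrow> \<exists>T. matula T = n"
proof (induction n rule: less_induct)
  case (less n)
  have "\<exists>T. nth_prime (matula T) = p" if "p \<in># prime_factorization n" for p
  proof -
    have "prime p" "p \<le> n"
      using that less.prems by (auto simp: in_prime_factors_iff dvd_imp_le)
    then obtain m where "m \<ge> 1" "p = nth_prime m"
      using prime_eq_nth_prime by blast
    then show ?thesis
      using less.IH[of m] less_nth_prime[of m] \<open>p \<le> n\<close> by auto
  qed
  then obtain b where b: "nth_prime (matula (b p)) = p" if "p \<in># prime_factorization n" for p
    by metis
  have "matula (Node (image_mset b (prime_factorization n))) = prod_mset (prime_factorization n)"
    using b by (auto simp: multiset.map_comp o_def intro!: arg_cong[of _ _ prod_mset] multiset.map_ident_strong)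
  then show ?case
    using less.prems by (metis prod_mset_prime_factorization_nat not_one_le_zero not_gr_zero)
qed

lemma tau_matula [simp]: "tau (matula T) = T"
  unfolding tau_def using matula_inj by blast

lemma matula_tau: "n \<ge> 1 \<Longrightarrow> matula (tau n) = n"
  using matula_surj tau_matula by metis

lemma tau_nth_prime: "t \<ge> 1 \<Longrightarrow> tau (nth_prime t) = Node {#tau t#}"
  using tau_matula[of "Node {#tau t#}"] by (simp add: matula_tau)

lemma tau_mult:
  assumes "r \<ge> 1" "s \<ge> 1" "tau r = Node A" "tau s = Node B"
  shows "tau (r * s) = Node (A + B)"
proof -
  have "matula (Node (A + B)) = r * s"
    using assms matula_tau[of r] matula_tau[of s] by simp
  then show ?thesis
    using tau_matula by metis
qed

lemma Omega_eq_size: "n \<ge> 1 \<Longrightarrow> tau n = Node M \<Longrightarrow> Omega n = size M"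
  using prime_factorization_matula[of M] matula_tau[of n] by (simp add: Omega_def)

lemma Omega_prime: "prime (p::nat) \<Longrightarrow> Omega p = 1"
  by (simp add: Omega_def prime_factorization_prime)

lemma prime_if_Omega_1:
  assumes "n \<ge> 1" "Omega n = 1"
  shows "prime n"
proof -
  obtain p where "prime_factorization n = {#p#}"
    using assms(2) size_1_singleton_mset unfolding Omega_def by blast
  then show ?thesis
    using prod_mset_prime_factorization_nat[of n] assms(1)
    by (metis in_prime_factors_iff add_mset_add_single prod_mset_singleton
        union_single_eq_member not_gr0 not_one_le_zero)
qed

section \<open>Distances between addresses\<close>

text \<open>
  The length of the path between two vertices through their lowest common ancestor: common initial
  steps are cancelled, and the remaining lengths are added.
\<close>

fun addr_dist :: "vertex \<Rightarrow> vertex \<Rightarrow> nat" where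
  "addr_dist (a # v) (b # w) =
    (if a = b then addr_dist v w else length (a # v) + length (b # w))"
| "addr_dist v w = length v + length w"

lemma addr_dist_Nil [simp]: "addr_dist [] v = length v" "addr_dist v [] = length v"
  by (cases v; simp)+

lemma addr_dist_self [simp]: "addr_dist v v = 0"
  by (induction v) auto

lemma addr_dist_commute: "addr_dist v w = addr_dist w v"
  by (induction v w rule: addr_dist.induct) auto

text \<open>
  Along an edge the distance changes by at most one, so no walk is shorter than \<open>addr_dist\<close>.
\<close>

lemma addr_dist_snoc:
  "addr_dist u (v @ [x]) \<le> addr_dist u v + 1 \<and> addr_dist u v \<le> addr_dist u (v @ [x]) + 1"
proof (induction u v rule: addr_dist.induct)
  case ("2_1" w)
  then show ?case by simp
next
  case ("2_2" v)
  then show ?case by (cases v) auto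
qed auto

lemma is_vertex_appendD: "is_vertex T (v @ w) \<Longrightarrow> is_vertex T v"
  by (induction T v rule: is_vertex.induct) auto

lemma adj_iff: "adj T v w \<longleftrightarrow> is_vertex T v \<and> is_vertex T w \<and> (\<exists>x. w = v @ [x] \<or> v = w @ [x])"
  by (auto simp: adj_def children_def verts_def)

lemma adj_commute: "adj T v w \<longleftrightarrow> adj T w v"
  by (auto simp: adj_iff)

lemma walk_reverse: "(adj T ^^ k) v w \<Longrightarrow> (adj T ^^ k) w v"
proof (induction k arbitrary: w)
  case (Suc k)
  then obtain u where "(adj T ^^ k) v u" "adj T u w"
    by auto
  then show ?case
    using Suc.IH adj_commute relpowp_Suc_I2 by metis
qed auto

lemma walk_from_root: "is_vertex T v \<Longrightarrow> (adj T ^^ length v) [] v"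
proof (induction v rule: rev_induct)
  case (snoc x v)
  then have "adj T v (v @ [x])"
    using is_vertex_appendD by (auto simp: adj_iff)
  then show ?case
    using snoc is_vertex_appendD by (auto intro: relpowp_Suc_I)
qed auto

lemma walk_in_branch:
  assumes "i < count M T"
  shows "(adj T ^^ k) v w \<Longrightarrow> (adj (Node M) ^^ k) ((T, i) # v) ((T, i) # w)"
proof (induction k arbitrary: w)
  case (Suc k)
  then obtain u where "(adj T ^^ k) v u" "adj T u w"
    by auto
  moreover from this have "adj (Node M) ((T, i) # u) ((T, i) # w)"
    using assms by (auto simp: adj_iff)
  ultimately show ?case
    using Suc.IH by (auto intro: relpowp_Suc_I)
qed auto

text \<open>
  A walk of the required length exists: inside a common branch it is lifted from the branch by
  \<open>walk_in_branch\<close>, and otherwise it goes up to the root and down again.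
\<close>

lemma walk_addr_dist:
  "is_vertex T v \<Longrightarrow> is_vertex T w \<Longrightarrow> (adj T ^^ addr_dist v w) v w"
proof (induction v w arbitrary: T rule: addr_dist.induct)
  case (1 a v b w)
  obtain M where T: "T = Node M"
    by (cases T)
  show ?case
  proof (cases "a = b")
    case True
    obtain S i where a: "a = (S, i)"
      by (cases a)
    then have "i < count M S" "is_vertex S v" "is_vertex S w"
      using 1 T True by auto
    then show ?thesis
      using walk_in_branch "1.IH" True T a by auto
  next
    case False
    have "(adj T ^^ (length (a # v) + length (b # w))) (a # v) (b # w)"
      using walk_from_root[OF "1.prems"(1)] walk_from_root[OF "1.prems"(2)] walk_reverse
      unfolding relpowp_add by blast
    then show ?thesis
      using False by (auto simp del: relpowp.simps)
  qed
next
  case ("2_1" w)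
  then show ?case using walk_from_root by auto
next
  case ("2_2" v)
  then show ?case using walk_from_root walk_reverse by force
qed

lemma addr_dist_le_walk: "(adj T ^^ k) v w \<Longrightarrow> addr_dist v w \<le> k"
proof (induction k arbitrary: w)
  case (Suc k)
  then obtain u where u: "(adj T ^^ k) v u" "adj T u w"
    by auto
  then have "addr_dist v w \<le> addr_dist v u + 1"
    using addr_dist_snoc by (auto simp: adj_iff)
  then show ?case
    using Suc.IH[OF u(1)] by simp
qed auto

lemma distance_eq_addr_dist:
  "v \<in> verts T \<Longrightarrow> w \<in> verts T \<Longrightarrow> distance T v w = addr_dist v w"
  unfolding distance_def verts_def
  by (intro Least_equality) (auto intro: walk_addr_dist addr_dist_le_walk)

lemma level_eq_length: "v \<in> verts T \<Longrightarrow> level T v = length v"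
  by (simp add: level_def distance_eq_addr_dist verts_def)

section \<open>Leaves and pendant vertices\<close>

lemma in_mset_if_less_count: "i < count M T \<Longrightarrow> T \<in># M"
  by (rule count_inI) simp

lemma finite_verts: "finite (verts T)"
proof (induction T)
  case (Node M)
  have "verts (Node M) \<subseteq> insert [] (\<Union>T\<in>set_mset M. \<Union>i<count M T. (#) (T, i) ` verts T)"
  proof
    fix v assume "v \<in> verts (Node M)"
    then show "v \<in> insert [] (\<Union>T\<in>set_mset M. \<Union>i<count M T. (#) (T, i) ` verts T)"
      by (cases "(Node M, v)" rule: is_vertex.cases)
        (auto simp: verts_def dest: in_mset_if_less_count)
  qed
  then show ?case
    by (rule finite_subset) (use Node.IH in auto)
qed

lemma leaves_subset_verts: "leaves T \<subseteq> verts T"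
  by (auto simp: leaves_def)

lemma finite_leaves: "finite (leaves T)"
  using finite_subset[OF leaves_subset_verts finite_verts] .

lemma children_root: "children (Node M) [] = (\<lambda>x. [x]) ` (SIGMA T:set_mset M. {..<count M T})"
  by (auto simp: children_def verts_def image_iff dest: in_mset_if_less_count)

lemma card_children_root: "card (children (Node M) []) = size M"
  unfolding children_root
  by (subst card_image) (auto simp: inj_on_def size_multiset_overloaded_eq)

lemma children_Cons:
  "i < count M T \<Longrightarrow> children (Node M) ((T, i) # v) = (#) (T, i) ` children T v"
  by (auto simp: children_def verts_def)

lemma root_notin_leaves [simp]: "[] \<notin> leaves T"
proof (cases T)
  case (Node M)
  have "children (Node M) [] \<noteq> {}" if "M \<noteq> {#}"
    using that card_children_root[of M] by (metis card.empty size_eq_0_iff_empty)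
  then show ?thesis
    by (auto simp: leaves_def Node)
qed

text \<open>
  The right-hand side speaks of childless vertices of \<open>T\<close> and not of \<open>leaves T\<close>, because the
  vertex of a trivial branch is a leaf of the large tree but not of the branch.
\<close>

lemma Cons_in_leaves_iff:
  "(T, i) # v \<in> leaves (Node M) \<longleftrightarrow> i < count M T \<and> v \<in> verts T \<and> children T v = {}"
  by (auto simp: leaves_def verts_def children_Cons)

lemma degree_root: "degree (Node M) [] = size M"
proof -
  have "{w. adj (Node M) [] w} = children (Node M) []"
    by (auto simp: adj_def children_def verts_def)
  then show ?thesis
    by (simp add: degree_def card_children_root)
qed

lemma degree_nonroot:
  assumes "v \<in> verts T" "v \<noteq> []"
  shows "degree T v = card (children T v) + 1"
proof -
  obtain u x where v: "v = u @ [x]"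
    using assms(2) rev_exhaust by blast
  have "{w. adj T v w} = insert u (children T v)"
    using assms(1) is_vertex_appendD[of T u "[x]"]
    by (auto simp: v adj_def children_def verts_def)
  moreover have "u \<notin> children T v"
    by (simp add: children_def v)
  moreover have "finite (children T v)"
    by (rule finite_subset[OF _ finite_verts]) (auto simp: children_def)
  ultimately show ?thesis
    by (simp add: degree_def)
qed

text \<open>
  A vertex other than the root has its parent as a neighbour, so it has degree 1 exactly when it
  has no children; the neighbours of the root are its children only.
\<close>

lemma pendant_eq: "pendant (Node M) = (if size M = 1 then insert [] (leaves (Node M)) else leaves (Node M))"
proof -
  have fin: "finite (children (Node M) v)" for v
    by (rule finite_subset[OF _ finite_verts]) (auto simp: children_def)
  have "v \<in> pendant (Node M) \<longleftrightarrow> v \<in> leaves (Node M)" if "v \<noteq> []" for v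
  proof -
    have "Node M \<noteq> Node {#}" if "v \<in> verts (Node M)"
      using that \<open>v \<noteq> []\<close> by (cases "(Node M, v)" rule: is_vertex.cases) (auto simp: verts_def)
    then show ?thesis
      using degree_nonroot[OF _ that] fin by (auto simp: pendant_def leaves_def)
  qed
  moreover have "[] \<in> pendant (Node M) \<longleftrightarrow> size M = 1"
    by (simp add: pendant_def degree_root verts_def)
  ultimately show ?thesis
    by (auto; metis root_notin_leaves)
qed

section \<open>Wiener sums\<close>

text \<open>
  The sum runs over ordered pairs, so it is twice the usual one; this makes it additive by plain
  manipulation of double sums.
\<close>

definition wiener_sum :: "vertex set \<Rightarrow> nat" where
  "wiener_sum A = (\<Sum>v\<in>A. \<Sum>w\<in>A. addr_dist v w)"

lemma wiener_sum_Un: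
  assumes "finite A" "finite B" "A \<inter> B = {}"
  shows "wiener_sum (A \<union> B) =
    wiener_sum A + wiener_sum B + 2 * (\<Sum>v\<in>A. \<Sum>w\<in>B. addr_dist v w)"
proof -
  have "(\<Sum>v\<in>B. \<Sum>w\<in>A. addr_dist v w) = (\<Sum>v\<in>A. \<Sum>w\<in>B. addr_dist v w)"
    by (subst sum.swap) (simp add: addr_dist_commute)
  then show ?thesis
    using assms by (simp add: wiener_sum_def sum.union_disjoint sum.distrib)
qed

lemma wiener_sum_image:
  assumes "inj_on f A" "\<And>v w. v \<in> A \<Longrightarrow> w \<in> A \<Longrightarrow> addr_dist (f v) (f w) = addr_dist v w"
  shows "wiener_sum (f ` A) = wiener_sum A"
  using assms by (simp add: wiener_sum_def sum.reindex cong: sum.cong)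

lemma wiener_sum_insert_root:
  "finite A \<Longrightarrow> [] \<notin> A \<Longrightarrow> wiener_sum (insert [] A) = wiener_sum A + 2 * (\<Sum>v\<in>A. length v)"
  using wiener_sum_Un[of "{[]}" A] by (simp add: wiener_sum_def)

lemma pair_distance_eq:
  assumes "v \<in> verts T" "w \<in> verts T"
  shows "pair_distance T {v, w} = addr_dist v w"
  unfolding pair_distance_def
proof (rule the_equality)
  show "\<exists>v' w'. {v, w} = {v', w'} \<and> addr_dist v w = distance T v' w'"
    using distance_eq_addr_dist[OF assms] by metis
qed (use assms in \<open>auto simp: doubleton_eq_iff distance_eq_addr_dist addr_dist_commute\<close>)

lemma sum_pair_distance:
  "finite A \<Longrightarrow> A \<subseteq> verts T \<Longrightarrow>
    2 * (\<Sum>e \<in> {e. e \<subseteq> A \<and> card e = 2}. pair_distance T e) = wiener_sum A"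
proof (induction A rule: finite_induct)
  case empty
  have "{e. e \<subseteq> ({}::vertex set) \<and> card e = 2} = {}"
    by auto
  then show ?case
    by (simp add: wiener_sum_def)
next
  case (insert x A)
  let ?P = "\<lambda>A. {e. e \<subseteq> A \<and> card e = 2}"
  have split: "?P (insert x A) = ?P A \<union> (\<lambda>y. {x, y}) ` A"
    using insert.hyps by (auto simp: card_2_iff)
  have "(\<Sum>e \<in> ?P (insert x A). pair_distance T e) =
      (\<Sum>e \<in> ?P A. pair_distance T e) + (\<Sum>e \<in> (\<lambda>y. {x, y}) ` A. pair_distance T e)"
    unfolding split using insert.hyps by (intro sum.union_disjoint) auto
  also have "(\<Sum>e \<in> (\<lambda>y. {x, y}) ` A. pair_distance T e) = (\<Sum>y\<in>A. pair_distance T {x, y})"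
    by (subst sum.reindex) (auto simp: inj_on_def doubleton_eq_iff)
  also have "\<dots> = (\<Sum>y\<in>A. addr_dist x y)"
    using insert.prems by (intro sum.cong) (auto simp: pair_distance_eq)
  finally show ?case
    using insert wiener_sum_Un[of "{x}" A] by (simp add: wiener_sum_def)
qed

lemma external_path_length_eq: "external_path_length T = (\<Sum>v\<in>leaves T. length v)"
  unfolding external_path_length_def
  by (intro sum.cong refl level_eq_length) (use leaves_subset_verts in blast)

lemma terminal_wiener_eq:
  "2 * terminal_wiener (Node M) = wiener_sum (leaves (Node M)) +
    (if size M = 1 then 2 * external_path_length (Node M) else 0)"
proof -
  have sub: "pendant (Node M) \<subseteq> verts (Node M)"
    by (auto simp: pendant_def)
  have "2 * terminal_wiener (Node M) = wiener_sum (pendant (Node M))"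
    unfolding terminal_wiener_def
    using sum_pair_distance[OF finite_subset[OF sub finite_verts] sub] .
  then show ?thesis
    by (simp add: pendant_eq wiener_sum_insert_root finite_leaves external_path_length_eq)
qed

section \<open>Planting and joining\<close>

text \<open>
  The one-vertex tree must be excluded: it has no leaves, but planting it creates one.
\<close>

lemma leaves_plant:
  assumes "T \<noteq> Node {#}"
  shows "leaves (Node {#T#}) = (#) (T, 0) ` leaves T"
proof (intro set_eqI)
  fix v
  show "v \<in> leaves (Node {#T#}) \<longleftrightarrow> v \<in> (#) (T, 0) ` leaves T"
  proof (cases v)
    case Nil
    then show ?thesis by auto
  next
    case (Cons a w)
    then show ?thesis
      using assms by (cases a) (auto simp: Cons_in_leaves_iff leaves_def[of T] split: if_splits)
  qed
qed

lemma statistics_plant: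
  assumes "T \<noteq> Node {#}"
  shows "wiener_sum (leaves (Node {#T#})) = wiener_sum (leaves T)"
    and "external_path_length (Node {#T#}) = external_path_length T + num_leaves T"
proof -
  show "wiener_sum (leaves (Node {#T#})) = wiener_sum (leaves T)"
    unfolding leaves_plant[OF assms] by (rule wiener_sum_image) auto
  show "external_path_length (Node {#T#}) = external_path_length T + num_leaves T"
    unfolding external_path_length_eq leaves_plant[OF assms] num_leaves_def
    by (simp add: sum.reindex sum_Suc)
qed

text \<open>
  The embedding of the tree with branches \<open>B\<close> into the one with branches \<open>A + B\<close>. The first
  \<open>count A T\<close> copies of a branch \<open>T\<close> belong to the part with branches \<open>A\<close>, so the copies
  coming from \<open>B\<close> are numbered after them.
\<close>

fun shift_copies :: "rtree multiset \<Rightarrow> vertex \<Rightarrow> vertex" where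
  "shift_copies A [] = []"
| "shift_copies A ((T, i) # v) = (T, count A T + i) # v"

lemma length_shift_copies [simp]: "length (shift_copies A v) = length v"
  by (cases "(A, v)" rule: shift_copies.cases) auto

lemma addr_dist_shift_copies [simp]:
  "addr_dist (shift_copies A v) (shift_copies A w) = addr_dist v w"
  by (cases "(A, v)" rule: shift_copies.cases; cases "(A, w)" rule: shift_copies.cases) auto

lemma inj_shift_copies: "inj (shift_copies A)"
proof (rule injI)
  fix v w
  show "shift_copies A v = shift_copies A w \<Longrightarrow> v = w"
    by (cases "(A, v)" rule: shift_copies.cases; cases "(A, w)" rule: shift_copies.cases) auto
qed

lemma leaves_join:
  "leaves (Node (A + B)) = leaves (Node A) \<union> shift_copies A ` leaves (Node B)"
proof (intro set_eqI)
  fix v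
  show "v \<in> leaves (Node (A + B)) \<longleftrightarrow> v \<in> leaves (Node A) \<union> shift_copies A ` leaves (Node B)"
  proof (cases "(A, v)" rule: shift_copies.cases)
    case (1 A')
    have "[] \<noteq> shift_copies A w" if "w \<in> leaves (Node B)" for w
      using that length_shift_copies[of A w] by (cases w) auto
    then show ?thesis
      using 1 by auto
  next
    case (2 A' T i w)
    have "(T, i) # w \<in> shift_copies A ` leaves (Node B) \<longleftrightarrow>
        count A T \<le> i \<and> (T, i - count A T) # w \<in> leaves (Node B)"
    proof
      assume "(T, i) # w \<in> shift_copies A ` leaves (Node B)"
      then obtain u where "u \<in> leaves (Node B)" "(T, i) # w = shift_copies A u"
        by auto
      then show "count A T \<le> i \<and> (T, i - count A T) # w \<in> leaves (Node B)"
        by (cases "(A, u)" rule: shift_copies.cases) auto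
    next
      assume "count A T \<le> i \<and> (T, i - count A T) # w \<in> leaves (Node B)"
      then show "(T, i) # w \<in> shift_copies A ` leaves (Node B)"
        by (intro image_eqI[of _ _ "(T, i - count A T) # w"]) auto
    qed
    then show ?thesis
      using 2 by (auto simp: Cons_in_leaves_iff)
  qed
qed

text \<open>
  The two addresses cannot share their first step, so the root is the lowest common ancestor.
\<close>

lemma addr_dist_across:
  assumes "v \<in> leaves (Node A)"
  shows "addr_dist v (shift_copies A w) = length v + length w"
proof (cases "(A, v)" rule: shift_copies.cases)
  case 1
  then show ?thesis by simp
next
  case (2 A' T i v')
  then have "i < count A T"
    using assms by (simp add: Cons_in_leaves_iff)
  then show ?thesis
    using 2 by (cases "(A, w)" rule: shift_copies.cases) auto
qed

lemma leaves_join_disjoint: "leaves (Node A) \<inter> shift_copies A ` leaves (Node B) = {}"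
proof -
  \<comment> \<open>A common vertex would have distance 0 from itself, so by \<open>addr_dist_across\<close> it would be the root.\<close>
  have "v \<noteq> shift_copies A w" if "v \<in> leaves (Node A)" for v w
    using addr_dist_across[OF that, of w] that by auto
  then show ?thesis
    by blast
qed

lemma wiener_sum_join:
  "wiener_sum (leaves (Node (A + B))) = wiener_sum (leaves (Node A)) + wiener_sum (leaves (Node B)) +
    2 * (external_path_length (Node A) * num_leaves (Node B) +
         external_path_length (Node B) * num_leaves (Node A))"
proof -
  have "(\<Sum>v\<in>leaves (Node A). \<Sum>w\<in>shift_copies A ` leaves (Node B). addr_dist v w) =
      (\<Sum>v\<in>leaves (Node A). \<Sum>w\<in>leaves (Node B). length v + length w)"
    by (rule sum.cong[OF refl], subst sum.reindex)
      (auto simp: addr_dist_across intro: inj_on_subset[OF inj_shift_copies])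
  also have "\<dots> = external_path_length (Node A) * num_leaves (Node B) +
         external_path_length (Node B) * num_leaves (Node A)"
    by (simp add: sum.distrib external_path_length_eq num_leaves_def sum_distrib_left mult.commute)
  finally show ?thesis
    unfolding leaves_join
    by (simp add: wiener_sum_Un finite_leaves leaves_join_disjoint wiener_sum_image
        inj_on_subset[OF inj_shift_copies])
qed

section \<open>The recurrence\<close>

lemma TW_eq:
  assumes "n \<ge> 1"
  shows "2 * TW n = int (wiener_sum (leaves (tau n))) + (if Omega n = 1 then 2 * EPL n else 0)"
proof -
  obtain M where "tau n = Node M"
    by (cases "tau n")
  then show ?thesis
    using arg_cong[OF terminal_wiener_eq[of M], of int] Omega_eq_size[OF assms]
    by (simp add: TW_def EPL_def split: if_splits)
qed

text \<open>
  The new root is pendant and contributes \<open>EPL t + LV t\<close>. If the old root was pendant, it loses its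
  contribution \<open>EPL t\<close>, which cancels.
\<close>

lemma TW_nth_prime:
  assumes "t \<ge> 2"
  shows "TW (nth_prime t) = TW t + (if Omega t = 1 then 0 else EPL t) + LV t"
proof -
  have "matula (Node {#}) = 1"
    by simp
  then have "tau t \<noteq> Node {#}"
    using assms matula_tau[of t] by fastforce
  note plant = statistics_plant[OF this]
  have "nth_prime t \<ge> 1"
    using prime_nth_prime[of t] prime_gt_0_nat by (simp add: Suc_leI)
  then have "2 * TW (nth_prime t) =
      int (wiener_sum (leaves (tau t))) + 2 * (EPL t + LV t)"
    using TW_eq[of "nth_prime t"] assms plant
    by (simp add: Omega_prime prime_nth_prime tau_nth_prime EPL_def LV_def)
  then show ?thesis
    using TW_eq[of t] assms by auto
qed

text \<open>
  The joined root has at least two children, so it is never pendant: each factor contributes only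
  its pairs of leaves, which for a prime factor means that the share of its root is taken away.
\<close>

lemma TW_mult:
  assumes "r \<ge> 2" "s \<ge> 2"
  shows "TW (r * s) = TW r - (if Omega r = 1 then EPL r else 0)
    + TW s - (if Omega s = 1 then EPL s else 0) + EPL r * LV s + EPL s * LV r"
proof -
  obtain A B where AB: "tau r = Node A" "tau s = Node B"
    by (metis rtree.exhaust)
  then have rs: "tau (r * s) = Node (A + B)"
    using assms by (simp add: tau_mult)
  have "r * s \<ge> 1"
    using assms by simp
  moreover have "Omega (r * s) \<noteq> 1"
    using prime_if_Omega_1[OF \<open>r * s \<ge> 1\<close>] assms prime_product[of r s] by auto
  ultimately have "2 * TW (r * s) =
      int (wiener_sum (leaves (tau r))) + int (wiener_sum (leaves (tau s))) +
      2 * (EPL r * LV s + EPL s * LV r)"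
    using TW_eq[of "r * s"] wiener_sum_join[of A B] AB rs by (simp add: EPL_def LV_def)
  then show ?thesis
    using TW_eq[of r] TW_eq[of s] assms by auto
qed

lemma TW_1: "TW 1 = 0"
proof -
  have "tau 1 = Node {#}"
    using tau_matula[of "Node {#}"] by simp
  moreover have "v \<notin> leaves (Node {#})" for v
    by (simp add: leaves_def)
  then have "leaves (Node {#}) = {}"
    by blast
  ultimately show ?thesis
    using terminal_wiener_eq[of "{#}"] by (simp add: TW_def wiener_sum_def)
qed

lemma TW_2: "TW 2 = 1"
proof -
  have n: "nth_prime 1 = 2"
  proof -
    obtain m where m: "m \<ge> 1" "2 = nth_prime m"
      using prime_eq_nth_prime[of 2] two_is_prime_nat by blast
    then have "m = 1"
      using less_nth_prime[of m] by simp
    then show ?thesis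
      using m by simp
  qed
  have "tau 1 = Node {#}"
    using tau_matula[of "Node {#}"] by simp
  then have t: "tau 2 = Node {#Node {#}#}"
    using tau_nth_prime[of 1] n by simp
  have ch: "children (Node {#}) [] = {}"
    by (simp add: children_root)
  have "v \<in> leaves (tau 2) \<longleftrightarrow> v = [(Node {#}, 0)]" for v
  proof (cases "(Node {#Node {#}#}, v)" rule: is_vertex.cases)
    case (2 M T i w)
    have "w \<in> verts (Node {#}) \<longleftrightarrow> w = []"
      by (cases "(Node {#}, w)" rule: is_vertex.cases) (auto simp: verts_def)
    then show ?thesis
      using 2 t ch by (auto simp: Cons_in_leaves_iff split: if_splits)
  qed auto
  then have "leaves (tau 2) = {[(Node {#}, 0)]}"
    by blast
  then show ?thesis
    using TW_eq[of 2] Omega_prime[of 2]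
    by (simp add: wiener_sum_def EPL_def external_path_length_eq)
qed

theorem proposition3p18:
  fixes n :: nat
  assumes "n \<ge> 1"
  shows "(n = 1 \<longrightarrow> TW n = 0) \<and>
    (n = 2 \<longrightarrow> TW n = 1) \<and>
    (\<forall>t\<ge>1. n = nth_prime t \<and> Omega t = 1 \<longrightarrow> TW n = TW t + LV t) \<and>
    (\<forall>t\<ge>1. n = nth_prime t \<and> Omega t > 1 \<longrightarrow> TW n = TW t + EPL t + LV t) \<and>
    (\<forall>r s. n = r * s \<and> r \<ge> 2 \<and> s \<ge> 2 \<and> prime r \<and> prime s \<longrightarrow>
      TW n = TW r - EPL r + TW s - EPL s + EPL r * LV s + EPL s * LV r) \<and>
    (\<forall>r s. n = r * s \<and> r \<ge> 2 \<and> s \<ge> 2 \<and> prime r \<and> \<not> prime s \<longrightarrow>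
      TW n = TW r - EPL r + TW s + EPL r * LV s + EPL s * LV r)"
proof -
  \<comment> \<open>The planting rule fails for \<open>t = 1\<close>; the conditions on \<open>Omega t\<close> exclude this index.\<close>
  have ge2: "t \<ge> 2" if "t \<ge> 1" "Omega t \<ge> 1" for t
  proof (rule ccontr)
    assume "\<not> t \<ge> 2"
    then have "t = 1"
      using that by simp
    then show False
      using that by (simp add: Omega_def)
  qed
  have "Omega s \<noteq> 1" if "s \<ge> 2" "\<not> prime s" for s
    using prime_if_Omega_1[of s] that by auto
  then show ?thesis
    using TW_1 TW_2 TW_nth_prime ge2 TW_mult Omega_prime by auto
qed

end
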